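(* Let $G\in\mathcal{L}_n^p$ and let $(A,B,C,D)$ be a balanced realization of $G(z)$. Then the chart associated with the output normal pair $(U,W)=(C,A)$ is an adapted chart for $G(z)$; that is, $G$ belongs to the domain of this chart and its Schur parameter $V$ in this chart is the zero matrix.
   Context: $^*$ denotes conjugate transpose. $\mathbf{T}$ is the unit circle. $G^\sharp(z)=G(1/\bar z)^*$. A $p\times p$ rational matrix function $G$ is lossless if $G(z)G(z)^*\le I_p$ for $|z|>1$, with equality for $|z|=1$; $\mathcal{L}_n^p$ is the set of $p\times p$ lossless functions of McMillan degree $n$. A realization $(A,B,C,D)$ of $G$ means $G(z)=D+C(zI_n-A)^{-1}B$; for a lossless function, a balanced realization is a minimal realization for which the realization matrix $\begin{pmatrix}D&C\\ B&A\end{pmatrix}$ is unitary. An output normal pair $(U,W)$ is an observable pair, $U$ of size $p\times n$, $W$ of size $n\times n$ and stable (eigenvalues in the open unit disk), with $U^*U+W^*W=I_n$. Chart associated with a single output normal pair $(U,W)$: for $G\in\mathcal{L}_n^p$, the Schur parameter is $V=\frac{1}{2i\pi}\int_{\mathbf{T}}G^\sharp(z)U(zI_n-W)^{-1}dz$, and $G$ belongs to the domain of the chart if the solution $P$ of $P-W^*PW=U^*U-V^*V$ is positive definite. (The remaining coordinate is a constant unitary matrix $G_0$, described by a local chart of the group of $p\times p$ unitary matrices around it.) A chart is an adapted chart for $G$ if $G$ lies in its domain and all the Schur parameters of $G$ in it are zero matrices. *)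

theory Defs
  imports
    "HOL-Complex_Analysis.Complex_Analysis"
    "Jordan_Normal_Form.Gauss_Jordan_Elimination"
    "Jordan_Normal_Form.Char_Poly"
    "Jordan_Normal_Form.Schur_Decomposition"
begin

text \<open>
  Matrices are those of Jordan_Normal_Form: the degree \<open>n\<close> must be able to vary (and to be 0),
  because minimality compares realizations of different state dimensions.
  The conjugate transpose is \<^const>\<open>mat_adjoint\<close>.
\<close>

definition hermitian_mat :: "complex mat \<Rightarrow> bool" where
  "hermitian_mat M \<longleftrightarrow> mat_adjoint M = M"

text \<open>Here \<open>(M *\<^sub>v v) \<bullet>c v\<close> is the quadratic form \<open>v\<^sup>* M v\<close>.\<close>

definition pos_semidef_mat :: "nat \<Rightarrow> complex mat \<Rightarrow> bool" where
  "pos_semidef_mat n M \<longleftrightarrow> M \<in> carrier_mat n n \<and> hermitian_mat M \<and>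
     (\<forall>v \<in> carrier_vec n. 0 \<le> Re ((M *\<^sub>v v) \<bullet>c v))"

definition pos_def_mat :: "nat \<Rightarrow> complex mat \<Rightarrow> bool" where
  "pos_def_mat n M \<longleftrightarrow> M \<in> carrier_mat n n \<and> hermitian_mat M \<and>
     (\<forall>v \<in> carrier_vec n. v \<noteq> 0\<^sub>v n \<longrightarrow> 0 < Re ((M *\<^sub>v v) \<bullet>c v))"

definition unitary_mat :: "nat \<Rightarrow> complex mat \<Rightarrow> bool" where
  "unitary_mat n M \<longleftrightarrow> M \<in> carrier_mat n n \<and>
     M * mat_adjoint M = 1\<^sub>m n \<and> mat_adjoint M * M = 1\<^sub>m n"

definition stable_mat :: "complex mat \<Rightarrow> bool" where
  "stable_mat A \<longleftrightarrow> (\<forall>e. eigenvalue A e \<longrightarrow> cmod e < 1)"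

text \<open>Meaningful only when \<open>z\<close> is not an eigenvalue of \<open>A\<close>.\<close>

definition resolvent :: "nat \<Rightarrow> complex mat \<Rightarrow> complex \<Rightarrow> complex mat" where
  "resolvent n A z = the (mat_inverse (z \<cdot>\<^sub>m 1\<^sub>m n - A))"

text \<open>
  A rational matrix function is represented by its evaluation map. As each entry is a reduced
  fraction, the value is determined (removable singularities included) except at the
  finitely many poles of the entries, where it is left arbitrary.
\<close>

definition rational_mat_fun :: "nat \<Rightarrow> (complex \<Rightarrow> complex mat) \<Rightarrow> bool" where
  "rational_mat_fun p G \<longleftrightarrow> (\<forall>z. G z \<in> carrier_mat p p) \<and>
     (\<forall>i<p. \<forall>j<p. \<exists>a b :: complex poly. b \<noteq> 0 \<and> Rings.coprime a b \<and>
        (\<forall>z. poly b z \<noteq> 0 \<longrightarrow> G z $$ (i, j) = poly a z / poly b z))"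

text \<open>
  No separate absence of poles is needed in \<open>|z| \<ge> 1\<close>: the bound near a pole in that region
  would be violated, whatever the value at the pole itself.
\<close>

definition lossless :: "nat \<Rightarrow> (complex \<Rightarrow> complex mat) \<Rightarrow> bool" where
  "lossless p G \<longleftrightarrow> rational_mat_fun p G \<and>
     (\<forall>z. cmod z > 1 \<longrightarrow> pos_semidef_mat p (1\<^sub>m p - G z * mat_adjoint (G z))) \<and>
     (\<forall>z. cmod z = 1 \<longrightarrow> G z * mat_adjoint (G z) = 1\<^sub>m p)"

text \<open>
  Equality of the rational functions \<open>G(z)\<close> and \<open>D + C (z I - A)\<^sup>-\<^sup>1 B\<close> amounts to equality
  of values wherever \<open>z I - A\<close> is invertible.
\<close>

definition realization ::
  "nat \<Rightarrow> nat \<Rightarrow> (complex \<Rightarrow> complex mat) \<Rightarrow>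
   complex mat \<Rightarrow> complex mat \<Rightarrow> complex mat \<Rightarrow> complex mat \<Rightarrow> bool" where
  "realization p n G A B C D \<longleftrightarrow>
     A \<in> carrier_mat n n \<and> B \<in> carrier_mat n p \<and> C \<in> carrier_mat p n \<and> D \<in> carrier_mat p p \<and>
     (\<forall>z. \<not> eigenvalue A z \<longrightarrow> G z = D + C * resolvent n A z * B)"

definition minimal_realization ::
  "nat \<Rightarrow> nat \<Rightarrow> (complex \<Rightarrow> complex mat) \<Rightarrow>
   complex mat \<Rightarrow> complex mat \<Rightarrow> complex mat \<Rightarrow> complex mat \<Rightarrow> bool" where
  "minimal_realization p n G A B C D \<longleftrightarrow> realization p n G A B C D \<and>
     (\<forall>m A' B' C' D'. realization p m G A' B' C' D' \<longrightarrow> n \<le> m)"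

definition has_McMillan_degree :: "nat \<Rightarrow> (complex \<Rightarrow> complex mat) \<Rightarrow> nat \<Rightarrow> bool" where
  "has_McMillan_degree p G n \<longleftrightarrow> (\<exists>A B C D. minimal_realization p n G A B C D)"

definition lossless_functions :: "nat \<Rightarrow> nat \<Rightarrow> (complex \<Rightarrow> complex mat) set" where
  "lossless_functions p n = {G. lossless p G \<and> has_McMillan_degree p G n}"

definition balanced_realization ::
  "nat \<Rightarrow> nat \<Rightarrow> (complex \<Rightarrow> complex mat) \<Rightarrow>
   complex mat \<Rightarrow> complex mat \<Rightarrow> complex mat \<Rightarrow> complex mat \<Rightarrow> bool" where
  "balanced_realization p n G A B C D \<longleftrightarrow>
     minimal_realization p n G A B C D \<and> unitary_mat (p + n) (four_block_mat D C B A)"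

text \<open>The observability matrix, with blocks \<open>U W\<^sup>k\<close> for \<open>k < n\<close>, has trivial kernel.\<close>

definition observable_pair :: "nat \<Rightarrow> complex mat \<Rightarrow> complex mat \<Rightarrow> bool" where
  "observable_pair n U W \<longleftrightarrow>
     (\<forall>x \<in> carrier_vec n. (\<forall>k<n. (U * W ^\<^sub>m k) *\<^sub>v x = 0\<^sub>v (dim_row U)) \<longrightarrow> x = 0\<^sub>v n)"

definition output_normal_pair :: "nat \<Rightarrow> nat \<Rightarrow> complex mat \<Rightarrow> complex mat \<Rightarrow> bool" where
  "output_normal_pair p n U W \<longleftrightarrow>
     U \<in> carrier_mat p n \<and> W \<in> carrier_mat n n \<and>
     observable_pair n U W \<and> stable_mat W \<and>
     mat_adjoint U * U + mat_adjoint W * W = 1\<^sub>m n"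

definition sharp :: "(complex \<Rightarrow> complex mat) \<Rightarrow> complex \<Rightarrow> complex mat" where
  "sharp G z = mat_adjoint (G (1 / cnj z))"

definition schur_parameter ::
  "nat \<Rightarrow> nat \<Rightarrow> complex mat \<Rightarrow> complex mat \<Rightarrow> (complex \<Rightarrow> complex mat) \<Rightarrow> complex mat" where
  "schur_parameter p n U W G = mat p n (\<lambda>(i, j).
     1 / (2 * \<i> * of_real pi) *
     contour_integral (circlepath 0 1) (\<lambda>z. (sharp G z * U * resolvent n W z) $$ (i, j)))"

definition stein_solution ::
  "nat \<Rightarrow> complex mat \<Rightarrow> complex mat \<Rightarrow> complex mat \<Rightarrow> complex mat \<Rightarrow> bool" where
  "stein_solution n U W V P \<longleftrightarrow> P \<in> carrier_mat n n \<and>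
     P - mat_adjoint W * P * W = mat_adjoint U * U - mat_adjoint V * V"

text \<open>
  ``The'' solution of the Stein equation: existence and uniqueness are part of the condition.
  The chart has one more coordinate, a unitary matrix; it lies in a local chart around itself
  and puts no restriction on \<open>G\<close>.
\<close>

definition in_chart_domain ::
  "nat \<Rightarrow> nat \<Rightarrow> complex mat \<Rightarrow> complex mat \<Rightarrow> (complex \<Rightarrow> complex mat) \<Rightarrow> bool" where
  "in_chart_domain p n U W G \<longleftrightarrow> G \<in> lossless_functions p n \<and>
     (\<exists>P. stein_solution n U W (schur_parameter p n U W G) P \<and>
          (\<forall>Q. stein_solution n U W (schur_parameter p n U W G) Q \<longrightarrow> Q = P) \<and>
          pos_def_mat n P)"

definition adapted_chart ::
  "nat \<Rightarrow> nat \<Rightarrow> complex mat \<Rightarrow> complex mat \<Rightarrow> (complex \<Rightarrow> complex mat) \<Rightarrow> bool" where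
  "adapted_chart p n U W G \<longleftrightarrow>
     in_chart_domain p n U W G \<and> schur_parameter p n U W G = 0\<^sub>m p n"

end

theory Submission
  imports Defs
begin

text \<open>
  Let \<open>R(z) = (z I - A)\<^sup>-\<^sup>1\<close>. Since the realization matrix is unitary,
  \<open>C\<^sup>* C + A\<^sup>* A = I\<close> and \<open>D\<^sup>* C + B\<^sup>* A = 0\<close>. These two relations give, on the unit circle,
  \<open>G\<^sup>\<sharp>(z) C R(z) = B\<^sup>* (I - z A\<^sup>*)\<^sup>-\<^sup>1\<close> (\<open>balanced_integrand_on_circle\<close>): the poles of
  \<open>R\<close> inside the disc cancel. If \<open>A\<close> is stable, the right-hand side is
  holomorphic on the closed disc, so its integral, the Schur parameter, is \<open>0\<close>
  (\<open>balanced_schur_parameter_zero\<close>). The Stein equation then becomes \<open>P - A\<^sup>* P A = C\<^sup>* C\<close>, which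
  the positive definite matrix \<open>P = I\<close> solves; stability makes the solution unique
  (\<open>stable_stein_homogeneous\<close>).

  What remains is that \<open>(C, A)\<close> is observable and \<open>A\<close> is stable. Both reduce to the fact that
  no eigenvector of \<open>A\<close> lies in the kernel of \<open>C\<close>
  (\<open>minimal_realization_no_unobservable_eigenvector\<close>). Otherwise the quotient of the state space
  by the line through such an eigenvector would carry a realization of \<open>G\<close> of smaller degree. An
  unobservable vector leads to such an eigenvector by multiplying with the factors
  \<open>A - e I\<close> of the characteristic polynomial (\<open>unobservable_vector_gives_eigenvector\<close>); and an
  eigenvalue of modulus at least \<open>1\<close> has, because of \<open>C\<^sup>* C + A\<^sup>* A = I\<close>, an eigenvector
  in the kernel of \<open>C\<close> (\<open>output_normal_stable\<close>).
\<close>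

(* Without these, the operators on vectors and matrices clash with those of Euclidean spaces. *)
unbundle no vec_syntax
unbundle no inner_syntax

section \<open>Conjugate transpose and the Hermitian form\<close>

lemma mat_adjoint_carrier [simp, intro]:
  "A \<in> carrier_mat m n \<Longrightarrow> mat_adjoint A \<in> carrier_mat n m"
  by (auto simp: mat_adjoint_def)

lemma dim_mat_adjoint [simp]:
  "dim_row (mat_adjoint A) = dim_col A" "dim_col (mat_adjoint A) = dim_row A"
  by (auto simp: mat_adjoint_def)

lemma mat_adjoint_index [simp]:
  fixes A :: "complex mat"
  shows "i < dim_col A \<Longrightarrow> j < dim_row A \<Longrightarrow> mat_adjoint A $$ (i, j) = cnj (A $$ (j, i))"
  by (simp add: mat_adjoint_def mat_of_rows_index)

lemma mat_adjoint_mult: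
  fixes A B :: "complex mat"
  assumes "A \<in> carrier_mat m n" "B \<in> carrier_mat n k"
  shows "mat_adjoint (A * B) = mat_adjoint B * mat_adjoint A"
  using assms by (intro eq_matI) (auto simp: scalar_prod_def mult.commute intro!: sum.cong)

lemma mat_adjoint_add:
  fixes A B :: "complex mat"
  assumes "A \<in> carrier_mat m n" "B \<in> carrier_mat m n"
  shows "mat_adjoint (A + B) = mat_adjoint A + mat_adjoint B"
  using assms by (intro eq_matI) auto

lemma mat_adjoint_shift:
  fixes A :: "complex mat"
  assumes "A \<in> carrier_mat n n"
  shows "mat_adjoint (a \<cdot>\<^sub>m 1\<^sub>m n - A) = cnj a \<cdot>\<^sub>m 1\<^sub>m n - mat_adjoint A"
  using assms by (intro eq_matI) auto

lemma mat_adjoint_one: "mat_adjoint (1\<^sub>m n :: complex mat) = 1\<^sub>m n"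
  by (intro eq_matI) auto

lemma mat_adjoint_four_block:
  fixes A B C D :: "complex mat"
  assumes "D \<in> carrier_mat p q" "C \<in> carrier_mat p n" "B \<in> carrier_mat m q" "A \<in> carrier_mat m n"
  shows "mat_adjoint (four_block_mat D C B A) =
    four_block_mat (mat_adjoint D) (mat_adjoint B) (mat_adjoint C) (mat_adjoint A)"
  using assms by (intro eq_matI) auto

lemma mat_adjoint_cscalar_prod:
  fixes M :: "complex mat"
  assumes M: "M \<in> carrier_mat m n" and u: "u \<in> carrier_vec m" and v: "v \<in> carrier_vec n"
  shows "(mat_adjoint M *\<^sub>v u) \<bullet>c v = u \<bullet>c (M *\<^sub>v v)"
proof -
  have "(mat_adjoint M *\<^sub>v u) \<bullet>c v = (\<Sum>i<n. \<Sum>j<m. cnj (M $$ (j, i)) * u $ j * cnj (v $ i))"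
    using assms by (simp add: scalar_prod_def sum_distrib_right atLeast0LessThan)
  also have "\<dots> = (\<Sum>j<m. \<Sum>i<n. cnj (M $$ (j, i)) * u $ j * cnj (v $ i))"
    by (rule sum.swap)
  also have "\<dots> = u \<bullet>c (M *\<^sub>v v)"
    using assms by (simp add: scalar_prod_def sum_distrib_left atLeast0LessThan mult_ac)
  finally show ?thesis .
qed

lemma cscalar_prod_self:
  fixes v :: "complex vec"
  assumes "v \<in> carrier_vec n"
  shows "v \<bullet>c v = of_real (\<Sum>i<n. (cmod (v $ i))\<^sup>2)"
  using assms by (simp add: scalar_prod_def atLeast0LessThan complex_norm_square del: of_real_power)

lemma cscalar_prod_self_pos:
  fixes v :: "complex vec"
  assumes v: "v \<in> carrier_vec n" and nz: "v \<noteq> 0\<^sub>v n"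
  shows "0 < Re (v \<bullet>c v)"
proof -
  obtain i where "i < n" "v $ i \<noteq> 0"
    using v nz by (metis carrier_vecD eq_vecI index_zero_vec(1,2))
  then show ?thesis
    using v by (auto simp: cscalar_prod_self intro!: sum_pos2[of _ i])
qed

lemma mat_eq_zeroI:
  fixes X :: "'a :: comm_ring_1 mat"
  assumes X: "X \<in> carrier_mat m n" and z: "\<And>v. v \<in> carrier_vec n \<Longrightarrow> X *\<^sub>v v = 0\<^sub>v m"
  shows "X = 0\<^sub>m m n"
proof (rule eq_matI)
  fix i j assume ij: "i < dim_row (0\<^sub>m m n :: 'a mat)" "j < dim_col (0\<^sub>m m n :: 'a mat)"
  then have "X $$ (i, j) = (X *\<^sub>v unit_vec n j) $ i"
    using X by auto
  then show "X $$ (i, j) = 0\<^sub>m m n $$ (i, j)"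
    using z[of "unit_vec n j"] ij by simp
qed (use X in auto)

section \<open>Inverses and resolvents\<close>

lemma mat_inverse_inverts:
  fixes M :: "complex mat"
  assumes M: "M \<in> carrier_mat n n"
    and ker: "\<And>v. v \<in> carrier_vec n \<Longrightarrow> M *\<^sub>v v = 0\<^sub>v n \<Longrightarrow> v = 0\<^sub>v n"
  shows "the (mat_inverse M) \<in> carrier_mat n n"
    "M * the (mat_inverse M) = 1\<^sub>m n" "the (mat_inverse M) * M = 1\<^sub>m n"
proof -
  have "det M \<noteq> 0"
    using ker unfolding det_0_iff_vec_prod_zero[OF M] by blast
  then have "mat_inverse M \<noteq> None"
    using mat_inverse(1)[OF M, where b = "()"] det_non_zero_imp_unit[OF M, where b = "()"] by blast
  then obtain N where "mat_inverse M = Some N" by blast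
  then show "the (mat_inverse M) \<in> carrier_mat n n"
    "M * the (mat_inverse M) = 1\<^sub>m n" "the (mat_inverse M) * M = 1\<^sub>m n"
    using mat_inverse(2)[OF M] by auto
qed

lemma smult_mat_mult_vec:
  fixes A :: "'a :: comm_ring_1 mat"
  assumes "A \<in> carrier_mat m n" "v \<in> carrier_vec n"
  shows "(a \<cdot>\<^sub>m A) *\<^sub>v v = a \<cdot>\<^sub>v (A *\<^sub>v v)"
  using assms by (intro eq_vecI) auto

lemma smult_one_minus_mult_vec:
  fixes A :: "complex mat"
  assumes "A \<in> carrier_mat n n" "v \<in> carrier_vec n"
  shows "(a \<cdot>\<^sub>m 1\<^sub>m n - A) *\<^sub>v v = a \<cdot>\<^sub>v v - A *\<^sub>v v"
proof -
  have "(a \<cdot>\<^sub>m 1\<^sub>m n) *\<^sub>v v = a \<cdot>\<^sub>v v"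
    using assms by (simp add: smult_mat_mult_vec[of _ n n])
  then show ?thesis
    using assms by (subst minus_mult_distrib_mat_vec[of _ n n]) auto
qed

lemma resolvent_inverts:
  assumes A: "A \<in> carrier_mat n n" and z: "\<not> eigenvalue A z"
  shows "resolvent n A z \<in> carrier_mat n n"
    "(z \<cdot>\<^sub>m 1\<^sub>m n - A) * resolvent n A z = 1\<^sub>m n"
    "resolvent n A z * (z \<cdot>\<^sub>m 1\<^sub>m n - A) = 1\<^sub>m n"
proof -
  have M: "z \<cdot>\<^sub>m 1\<^sub>m n - A \<in> carrier_mat n n" using A by auto
  have ker: "v = 0\<^sub>v n" if v: "v \<in> carrier_vec n" and 0: "(z \<cdot>\<^sub>m 1\<^sub>m n - A) *\<^sub>v v = 0\<^sub>v n" for v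
  proof (rule ccontr)
    assume nz: "v \<noteq> 0\<^sub>v n"
    have eq: "z \<cdot>\<^sub>v v - A *\<^sub>v v = 0\<^sub>v n"
      using 0 smult_one_minus_mult_vec[OF A v] by simp
    have "(A *\<^sub>v v) $ i = (z \<cdot>\<^sub>v v) $ i" if "i < n" for i
      using arg_cong[OF eq, of "\<lambda>w :: complex vec. w $ i"] A v that
      by auto
    then have "A *\<^sub>v v = z \<cdot>\<^sub>v v" using A v by (intro eq_vecI) auto
    then have "eigenvalue A z"
      using A v nz unfolding eigenvalue_def eigenvector_def by auto
    then show False using z by simp
  qed
  show "resolvent n A z \<in> carrier_mat n n"
    "(z \<cdot>\<^sub>m 1\<^sub>m n - A) * resolvent n A z = 1\<^sub>m n"
    "resolvent n A z * (z \<cdot>\<^sub>m 1\<^sub>m n - A) = 1\<^sub>m n"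
    unfolding resolvent_def using mat_inverse_inverts[OF M ker] by auto
qed

lemma det_holomorphic_on:
  assumes "\<And>z. M z \<in> carrier_mat n n"
    and "\<And>i j. i < n \<Longrightarrow> j < n \<Longrightarrow> (\<lambda>z. M z $$ (i, j)) holomorphic_on S"
  shows "(\<lambda>z. det (M z)) holomorphic_on S"
  unfolding det_def'[OF assms(1)]
  by (intro holomorphic_intros assms) (auto simp: permutes_in_image)

text \<open>
  By Cramer's rule the entries of an inverse are quotients of polynomials in the entries of the
  matrix. The function \<open>N\<close> is constrained on \<open>S\<close> only, because resolvents have junk values
  at eigenvalues; \<open>S\<close> may be closed, so that the closed unit disc is covered.
\<close>

lemma inverse_entry_holomorphic_on:
  fixes M N :: "complex \<Rightarrow> complex mat"
  assumes M: "\<And>z. M z \<in> carrier_mat n n"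
    and hol: "\<And>i j. i < n \<Longrightarrow> j < n \<Longrightarrow> (\<lambda>z. M z $$ (i, j)) holomorphic_on S"
    and N: "\<And>z. z \<in> S \<Longrightarrow> N z \<in> carrier_mat n n"
    and inv: "\<And>z. z \<in> S \<Longrightarrow> M z * N z = 1\<^sub>m n"
    and ij: "i < n" "j < n"
  shows "(\<lambda>z. N z $$ (i, j)) holomorphic_on S"
proof -
  have det: "det (M z) \<noteq> 0" if "z \<in> S" for z
    using det_mult[OF M N[OF that], of z] inv[OF that] by auto
  have entry: "N z $$ (i, j) = adj_mat (M z) $$ (i, j) / det (M z)" if z: "z \<in> S" for z
  proof -
    have "adj_mat (M z) = adj_mat (M z) * (M z * N z)"
      using adj_mat(1)[OF M[of z]] inv[OF z] by simp
    also have "\<dots> = adj_mat (M z) * M z * N z"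
      using adj_mat(1)[OF M[of z]] M[of z] N[OF z] by simp
    also have "\<dots> = det (M z) \<cdot>\<^sub>m N z"
      using adj_mat(3)[OF M[of z]] N[OF z]
      by (simp add: mult_smult_assoc_mat[OF one_carrier_mat N[OF z]])
    finally show ?thesis using N[OF z] ij det[OF z] by simp
  qed
  have adj: "(\<lambda>z. adj_mat (M z) $$ (i, j)) holomorphic_on S"
  proof -
    have eq: "adj_mat (M z) $$ (i, j) = (-1) ^ (j + i) * det (mat_delete (M z) j i)" for z
      using ij M[of z] by (auto simp: adj_mat_def cofactor_def)
    have "(\<lambda>z. det (mat_delete (M z) j i)) holomorphic_on S"
    proof (rule det_holomorphic_on[where n = "n - 1"])
      fix k l assume "k < n - 1" "l < n - 1"
      then show "(\<lambda>z. mat_delete (M z) j i $$ (k, l)) holomorphic_on S"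
        using ij M by (auto simp: mat_delete_def carrier_matD[OF M] intro!: hol)
    qed (rule mat_delete_carrier[OF M])
    then show ?thesis unfolding eq by (intro holomorphic_intros)
  qed
  have "(\<lambda>z. adj_mat (M z) $$ (i, j) / det (M z)) holomorphic_on S"
    using adj det det_holomorphic_on[OF M hol] by (intro holomorphic_intros) auto
  then show ?thesis
    using entry by (simp cong: holomorphic_cong)
qed

lemma finite_eigenvalues:
  fixes A :: "complex mat"
  assumes "A \<in> carrier_mat n n"
  shows "finite {z. eigenvalue A z}"
proof -
  have "char_poly A \<noteq> 0" using degree_monic_char_poly[OF assms] by auto
  then show ?thesis
    unfolding eigenvalue_root_char_poly[OF assms] by (rule poly_roots_finite)
qed

lemma resolvent_entry_isCont:
  assumes A: "A \<in> carrier_mat n n" and z: "\<not> eigenvalue A z" and ij: "i < n" "j < n"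
  shows "isCont (\<lambda>w. resolvent n A w $$ (i, j)) z"
proof -
  let ?S = "- {w. eigenvalue A w}"
  have "(\<lambda>w. resolvent n A w $$ (i, j)) holomorphic_on ?S"
  proof (rule inverse_entry_holomorphic_on[where M = "\<lambda>w. w \<cdot>\<^sub>m 1\<^sub>m n - A"])
    show "w \<cdot>\<^sub>m 1\<^sub>m n - A \<in> carrier_mat n n" for w using A by auto
    show "(\<lambda>w. (w \<cdot>\<^sub>m 1\<^sub>m n - A) $$ (k, l)) holomorphic_on ?S" if "k < n" "l < n" for k l
      using A that by (auto intro!: holomorphic_intros)
  qed (use A ij resolvent_inverts in auto)
  moreover have "open ?S" using finite_eigenvalues[OF A] by (simp add: finite_imp_closed open_Compl)
  ultimately show ?thesis
    using z holomorphic_on_imp_continuous_on continuous_on_interior interior_open by blast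
qed

section \<open>Eliminating the eigenvalues one by one\<close>

text \<open>
  The Cayley--Hamilton theorem in the form used for inductions: the factors \<open>A - e I\<close> of the
  characteristic polynomial are applied to a vector one at a time, so that a property of vectors can
  be traced through the intermediate ones. In a basis that makes \<open>A\<close> upper triangular, each
  factor, taken from the last diagonal entry to the first, kills one more trailing coordinate.
\<close>

lemma eigenvalues_annihilate:
  fixes A :: "complex mat"
  assumes A: "A \<in> carrier_mat n n"
  shows "\<exists>es. length es = n \<and> (\<forall>e\<in>set es. eigenvalue A e) \<and>
    (\<forall>x\<in>carrier_vec n. fold (\<lambda>e v. A *\<^sub>v v - e \<cdot>\<^sub>v v) es x = 0\<^sub>v n)"
proof -
  obtain ds where ds: "char_poly A = (\<Prod>a\<leftarrow>ds. [:- a, 1:])" and len: "length ds = n"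
    using char_poly_factorized[OF A] by blast
  obtain T P Q where "schur_decomposition A ds = (T, P, Q)"
    by (metis prod_cases3)
  from schur_decomposition[OF A ds this]
  have sim: "similar_mat_wit A T P Q" and ut: "upper_triangular T" and diag: "diag_mat T = ds"
    by auto
  note S = similar_mat_witD2[OF A sim]
  have QA: "Q * A = T * Q"
  proof -
    have "Q * A = Q * (P * T * Q)" using S(3) by simp
    also have "\<dots> = Q * P * (T * Q)" using S(5-7) by (simp add: assoc_mult_mat[of _ n n _ n _ n])
    also have "\<dots> = T * Q" using S(2,5,7) by simp
    finally show ?thesis .
  qed
  let ?f = "\<lambda>e v. A *\<^sub>v v - e \<cdot>\<^sub>v v"
  \<comment> \<open>The vectors with vanishing coordinates from \<open>k\<close> on form the flag of the triangular form.\<close>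
  have step: "fold ?f (rev (take k ds)) y = 0\<^sub>v n"
    if "k \<le> n" "y \<in> carrier_vec n" "\<And>i. k \<le> i \<Longrightarrow> i < n \<Longrightarrow> (Q *\<^sub>v y) $ i = 0" for k y
    using that
  proof (induction k arbitrary: y)
    case 0
    have "Q *\<^sub>v y = 0\<^sub>v n" using 0 S(7) by (intro eq_vecI) auto
    then have "P *\<^sub>v (Q *\<^sub>v y) = 0\<^sub>v n" using S(6) by auto
    moreover have "P *\<^sub>v (Q *\<^sub>v y) = y"
      using S(1,6,7) 0(2) by (metis assoc_mult_mat_vec one_mult_mat_vec)
    ultimately show ?case by simp
  next
    case (Suc k)
    then have k: "k < n" by simp
    let ?w = "?f (ds ! k) y"
    have w: "?w \<in> carrier_vec n" using A Suc.prems by auto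
    have dk: "ds ! k = T $$ (k, k)" using diag k S(5) by (auto simp: diag_mat_def)
    have Qw: "Q *\<^sub>v ?w = T *\<^sub>v (Q *\<^sub>v y) - ds ! k \<cdot>\<^sub>v (Q *\<^sub>v y)"
    proof -
      have "Q *\<^sub>v ?w = Q *\<^sub>v (A *\<^sub>v y) - Q *\<^sub>v (ds ! k \<cdot>\<^sub>v y)"
        using A S(7) Suc.prems by (intro mult_minus_distrib_mat_vec) auto
      also have "Q *\<^sub>v (A *\<^sub>v y) = T *\<^sub>v (Q *\<^sub>v y)"
        using A S(5,7) Suc.prems(2) QA by (metis assoc_mult_mat_vec)
      also have "Q *\<^sub>v (ds ! k \<cdot>\<^sub>v y) = ds ! k \<cdot>\<^sub>v (Q *\<^sub>v y)"
        using S(7) Suc.prems(2) by (rule mult_mat_vec)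
      finally show ?thesis .
    qed
    have zero: "(Q *\<^sub>v ?w) $ i = 0" if i: "k \<le> i" "i < n" for i
    proof -
      have "(T *\<^sub>v (Q *\<^sub>v y)) $ i = (\<Sum>j<n. T $$ (i, j) * (Q *\<^sub>v y) $ j)"
        using S(5,7) i by (simp add: scalar_prod_def atLeast0LessThan)
      also have "\<dots> = (\<Sum>j<n. if j = k then T $$ (i, k) * (Q *\<^sub>v y) $ k else 0)"
      proof (rule sum.cong)
        fix j assume j: "j \<in> {..<n}"
        show "T $$ (i, j) * (Q *\<^sub>v y) $ j = (if j = k then T $$ (i, k) * (Q *\<^sub>v y) $ k else 0)"
        proof (cases j k rule: linorder_cases)
          case less
          then show ?thesis using upper_triangularD[OF ut, of j i] i S(5) by auto
        next
          case greater
          then show ?thesis using Suc.prems(3)[of j] j by auto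
        qed auto
      qed simp
      also have "\<dots> = T $$ (i, k) * (Q *\<^sub>v y) $ k" using k by simp
      finally have "(Q *\<^sub>v ?w) $ i = T $$ (i, k) * (Q *\<^sub>v y) $ k - ds ! k * (Q *\<^sub>v y) $ i"
        unfolding Qw using S(5,7) i by simp
      also have "\<dots> = 0"
      proof (cases "i = k")
        case False
        then show ?thesis
          using upper_triangularD[OF ut, of k i] i S(5) Suc.prems(3)[of i] by auto
      qed (simp add: dk)
      finally show ?thesis .
    qed
    have "rev (take (Suc k) ds) = ds ! k # rev (take k ds)"
      using k len by (simp add: take_Suc_conv_app_nth)
    then show ?case using Suc.IH[OF _ w zero] k by simp
  qed
  show ?thesis
  proof (intro exI[of _ "rev ds"] conjI ballI)
    show "fold ?f (rev ds) x = 0\<^sub>v n" if "x \<in> carrier_vec n" for x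
      using step[of n x] that len by simp
    show "eigenvalue A e" if "e \<in> set (rev ds)" for e
    proof -
      have "[:- e, 1:] dvd char_poly A"
        unfolding ds using that by (intro prod_list_dvd) auto
      then show ?thesis
        by (auto simp: eigenvalue_root_char_poly[OF A] poly_eq_0_iff_dvd)
    qed
  qed (simp add: len)
qed

section \<open>Observability of minimal realizations\<close>

text \<open>
  This is the Hautus test. Among the vectors obtained from \<open>x\<close> by applying the factors
  \<open>A - e I\<close> in turn, the last nonzero one is an eigenvector. It is a combination of
  \<open>A\<^sup>k x\<close> with \<open>k\<close> smaller than the number of factors, hence it is still in the
  kernel of \<open>C\<close>.
\<close>

lemma unobservable_vector_gives_eigenvector:
  fixes A C :: "complex mat"
  assumes A: "A \<in> carrier_mat n n" and C: "C \<in> carrier_mat p n"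
    and "x \<in> carrier_vec n" "x \<noteq> 0\<^sub>v n"
    and "fold (\<lambda>e v. A *\<^sub>v v - e \<cdot>\<^sub>v v) es x = 0\<^sub>v n"
    and "\<And>k. k < length es \<Longrightarrow> (C * A ^\<^sub>m k) *\<^sub>v x = 0\<^sub>v p"
  shows "\<exists>y e. eigenvector A y e \<and> C *\<^sub>v y = 0\<^sub>v p"
  using assms(3-)
proof (induction es arbitrary: x)
  case Nil
  then show ?case by simp
next
  case (Cons e es)
  let ?w = "A *\<^sub>v x - e \<cdot>\<^sub>v x"
  have w: "?w \<in> carrier_vec n" using A Cons.prems by auto
  show ?case
  proof (cases "?w = 0\<^sub>v n")
    case True
    have "(A *\<^sub>v x) $ i = (e \<cdot>\<^sub>v x) $ i" if "i < n" for i
      using arg_cong[OF True, of "\<lambda>w :: complex vec. w $ i"] A Cons.prems(1) that by auto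
    then have "A *\<^sub>v x = e \<cdot>\<^sub>v x" using A Cons.prems by (intro eq_vecI) auto
    then have "eigenvector A x e"
      using A Cons.prems by (auto simp: eigenvector_def)
    moreover have "C *\<^sub>v x = 0\<^sub>v p" using Cons.prems(4)[of 0] A C by simp
    ultimately show ?thesis by blast
  next
    case False
    show ?thesis
    proof (rule Cons.IH[OF w False])
      show "fold (\<lambda>e v. A *\<^sub>v v - e \<cdot>\<^sub>v v) es ?w = 0\<^sub>v n" using Cons.prems(3) by simp
      fix k assume k: "k < length es"
      have CA: "C * A ^\<^sub>m k \<in> carrier_mat p n" using A C by auto
      have "(C * A ^\<^sub>m k) *\<^sub>v ?w = (C * A ^\<^sub>m k) *\<^sub>v (A *\<^sub>v x) - (C * A ^\<^sub>m k) *\<^sub>v (e \<cdot>\<^sub>v x)"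
        using CA A Cons.prems(1) by (intro mult_minus_distrib_mat_vec) auto
      also have "(C * A ^\<^sub>m k) *\<^sub>v (A *\<^sub>v x) = (C * A ^\<^sub>m Suc k) *\<^sub>v x"
      proof -
        have "C * A ^\<^sub>m Suc k = C * A ^\<^sub>m k * A"
          using A C by (simp add: assoc_mult_mat[of _ p n _ n _ n])
        then show ?thesis
          using CA A Cons.prems(1) by (simp add: assoc_mult_mat_vec)
      qed
      also have "(C * A ^\<^sub>m Suc k) *\<^sub>v x = 0\<^sub>v p" using Cons.prems(4)[of "Suc k"] k by simp
      also have "(C * A ^\<^sub>m k) *\<^sub>v (e \<cdot>\<^sub>v x) = e \<cdot>\<^sub>v ((C * A ^\<^sub>m k) *\<^sub>v x)"
        using CA Cons.prems(1) by (rule mult_mat_vec)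
      also have "(C * A ^\<^sub>m k) *\<^sub>v x = 0\<^sub>v p" using Cons.prems(4)[of k] k by simp
      finally show "(C * A ^\<^sub>m k) *\<^sub>v ?w = 0\<^sub>v p" by auto
    qed
  qed
qed

lemma eventually_at_notin_finite:
  fixes z :: complex
  assumes "finite N"
  shows "eventually (\<lambda>w. w \<notin> N) (at z)"
proof -
  have "open (- (N - {z}))" using assms by (intro open_Compl finite_imp_closed finite_Diff)
  then show ?thesis
    unfolding eventually_at_topological by (intro exI[of _ "- (N - {z})"]) auto
qed

text \<open>
  A value of a reduced fraction is forced by nearby values: if a continuous function agrees with
  \<open>a / b\<close> near \<open>z0\<close>, then \<open>f b = a\<close> at \<open>z0\<close>, so a zero of \<open>b\<close> there would be a common
  zero of \<open>a\<close> and \<open>b\<close>.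
\<close>

lemma reduced_fraction_value:
  fixes a b :: "complex poly"
  assumes b: "b \<noteq> 0" and cop: "Rings.coprime a b"
    and g: "\<And>z. poly b z \<noteq> 0 \<Longrightarrow> g z = poly a z / poly b z"
    and f: "isCont f z0" and ev: "eventually (\<lambda>z. g z = f z) (at z0)"
  shows "g z0 = f z0"
proof -
  have "finite {z. poly b z = 0}" using b by (rule poly_roots_finite)
  then have "eventually (\<lambda>z. z \<notin> {z. poly b z = 0}) (at z0)"
    by (rule eventually_at_notin_finite)
  then have "eventually (\<lambda>z. f z * poly b z = poly a z) (at z0)"
    using ev
  proof eventually_elim
    case (elim z)
    then have "f z = poly a z / poly b z" using g[of z] by simp
    then show ?case using elim by simp
  qed
  moreover have "((\<lambda>z. f z * poly b z) \<longlongrightarrow> f z0 * poly b z0) (at z0)"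
    using f by (intro tendsto_intros) (auto simp: isCont_def intro: poly_isCont[unfolded isCont_def])
  ultimately have "(poly a \<longlongrightarrow> f z0 * poly b z0) (at z0)"
    by (rule Lim_transform_eventually[rotated])
  moreover have "(poly a \<longlongrightarrow> poly a z0) (at z0)"
    using poly_isCont[of z0 a] by (simp add: isCont_def)
  ultimately have eq: "poly a z0 = f z0 * poly b z0"
    by (metis LIM_unique)
  have "poly b z0 \<noteq> 0"
  proof
    assume "poly b z0 = 0"
    then have "[:- z0, 1:] dvd a" "[:- z0, 1:] dvd b"
      using eq by (auto simp: poly_eq_0_iff_dvd)
    then have "is_unit [:- z0, 1:]" using cop by (rule coprime_common_divisor[rotated 1])
    then show False by (simp add: is_unit_iff_degree)
  qed
  then show ?thesis using g[of z0] eq by simp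
qed

lemma transfer_entry_isCont:
  assumes A: "A \<in> carrier_mat n n" and B: "B \<in> carrier_mat n p"
    and C: "C \<in> carrier_mat p n" and D: "D \<in> carrier_mat p p"
    and z: "\<not> eigenvalue A z" and ij: "i < p" "j < p"
  shows "isCont (\<lambda>w. (D + C * resolvent n A w * B) $$ (i, j)) z"
proof -
  have fin: "finite {w. eigenvalue A w}" by (rule finite_eigenvalues[OF A])
  have ev: "eventually (\<lambda>w. w \<notin> {w. eigenvalue A w}) (nhds z)"
    using eventually_nhds_in_open[of "- {w. eigenvalue A w}" z] fin z
    by (simp add: finite_imp_closed open_Compl)
  have entry: "(D + C * resolvent n A w * B) $$ (i, j) =
      D $$ (i, j) + (\<Sum>k<n. C $$ (i, k) * (\<Sum>l<n. resolvent n A w $$ (k, l) * B $$ (l, j)))"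
    if "\<not> eigenvalue A w" for w
    using resolvent_inverts(1)[OF A that] B C D ij
    by (simp add: scalar_prod_def atLeast0LessThan)
  have "isCont (\<lambda>w. D $$ (i, j) +
      (\<Sum>k<n. C $$ (i, k) * (\<Sum>l<n. resolvent n A w $$ (k, l) * B $$ (l, j)))) z"
    using resolvent_entry_isCont[OF A z] by (intro continuous_intros) auto
  then show ?thesis
    using isCont_cong[OF eventually_mono[OF ev, where Q = "\<lambda>w. (D + C * resolvent n A w * B) $$ (i, j) =
      D $$ (i, j) + (\<Sum>k<n. C $$ (i, k) * (\<Sum>l<n. resolvent n A w $$ (k, l) * B $$ (l, j)))"]] entry
    by simp
qed

text \<open>
  Passing to a smaller state space preserves the transfer function only off the eigenvalues of both
  state matrices. The points where the larger state matrix is singular while the smaller one is not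
  are removable singularities, and there the value of a rational function is determined.
\<close>

lemma realization_of_almost_everywhere:
  assumes G: "rational_mat_fun p G"
    and A: "A \<in> carrier_mat n n" and B: "B \<in> carrier_mat n p"
    and C: "C \<in> carrier_mat p n" and D: "D \<in> carrier_mat p p"
    and fin: "finite N"
    and eq: "\<And>z. z \<notin> N \<Longrightarrow> G z = D + C * resolvent n A z * B"
  shows "realization p n G A B C D"
  unfolding realization_def
proof (intro conjI allI impI A B C D)
  fix z assume z: "\<not> eigenvalue A z"
  have car: "G z \<in> carrier_mat p p" using G by (simp add: rational_mat_fun_def)
  show "G z = D + C * resolvent n A z * B"
  proof (rule eq_matI)
    fix i j assume "i < dim_row (D + C * resolvent n A z * B)" "j < dim_col (D + C * resolvent n A z * B)"
    then have ij: "i < p" "j < p" using B C by auto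
    obtain a b :: "complex poly" where "b \<noteq> 0" "Rings.coprime a b"
      "\<And>z. poly b z \<noteq> 0 \<Longrightarrow> G z $$ (i, j) = poly a z / poly b z"
      using G ij unfolding rational_mat_fun_def by metis
    moreover note transfer_entry_isCont[OF A B C D z ij]
    moreover have "eventually (\<lambda>z. z \<notin> N) (at z)"
      using fin by (rule eventually_at_notin_finite)
    then have "eventually (\<lambda>w. G w $$ (i, j) = (D + C * resolvent n A w * B) $$ (i, j)) (at z)"
      by eventually_elim (simp add: eq)
    ultimately show "G z $$ (i, j) = (D + C * resolvent n A z * B) $$ (i, j)"
      by (rule reduced_fraction_value)
  qed (use car B C in auto)
qed

text \<open>
  The hypotheses say that \<open>E\<close> intertwines \<open>A\<close> with \<open>E A F\<close> and that \<open>C\<close> factors through \<open>E\<close>;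
  the resolvents are then intertwined by \<open>E\<close> as well. This is the situation of a
  quotient of the state space by an \<open>A\<close>-invariant subspace of the kernel of \<open>C\<close>.
\<close>

lemma transfer_function_compression:
  assumes A: "A \<in> carrier_mat n n" and B: "B \<in> carrier_mat n p" and C: "C \<in> carrier_mat p n"
    and E: "E \<in> carrier_mat m n" and F: "F \<in> carrier_mat n m"
    and EA: "E * A * F * E = E * A" and CFE: "C * F * E = C"
    and z: "\<not> eigenvalue A z" and z': "\<not> eigenvalue (E * A * F) z"
  shows "C * F * resolvent m (E * A * F) z * (E * B) = C * resolvent n A z * B"
proof -
  let ?A' = "E * A * F"
  have A': "?A' \<in> carrier_mat m m" using E A F by auto
  note R = resolvent_inverts[OF A z] and R' = resolvent_inverts[OF A' z']
  have Z: "z \<cdot>\<^sub>m 1\<^sub>m m - ?A' \<in> carrier_mat m m" "z \<cdot>\<^sub>m 1\<^sub>m n - A \<in> carrier_mat n n"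
    using A A' by (auto intro: minus_carrier_mat)
  let ?R = "resolvent n A z" and ?R' = "resolvent m ?A' z"
  have inter: "(z \<cdot>\<^sub>m 1\<^sub>m m - ?A') * E = E * (z \<cdot>\<^sub>m 1\<^sub>m n - A)"
  proof -
    have "(z \<cdot>\<^sub>m 1\<^sub>m m - ?A') * E = z \<cdot>\<^sub>m 1\<^sub>m m * E - ?A' * E"
      using A' E by (intro minus_mult_distrib_mat) auto
    also have "z \<cdot>\<^sub>m 1\<^sub>m m * E = E * (z \<cdot>\<^sub>m 1\<^sub>m n)"
      using E by (simp add: mult_smult_distrib[OF E one_carrier_mat] mult_smult_assoc_mat[OF one_carrier_mat E])
    also have "E * (z \<cdot>\<^sub>m 1\<^sub>m n) - ?A' * E = E * (z \<cdot>\<^sub>m 1\<^sub>m n - A)"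
      unfolding EA using E A by (intro mult_minus_distrib_mat[symmetric]) auto
    finally show ?thesis .
  qed
  have ER: "?R' * E = E * ?R"
  proof -
    have "E * ?R = ?R' * (z \<cdot>\<^sub>m 1\<^sub>m m - ?A') * (E * ?R)"
      using R(1) R'(3) E by simp
    also have "\<dots> = ?R' * ((z \<cdot>\<^sub>m 1\<^sub>m m - ?A') * E * ?R)"
      unfolding assoc_mult_mat[OF R'(1) Z(1) mult_carrier_mat[OF E R(1)]]
        assoc_mult_mat[OF Z(1) E R(1)] ..
    also have "\<dots> = ?R' * (E * ((z \<cdot>\<^sub>m 1\<^sub>m n - A) * ?R))"
      unfolding inter using assoc_mult_mat[OF E Z(2) R(1)] by simp
    also have "\<dots> = ?R' * E" using R(2) E by simp
    finally show ?thesis ..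
  qed
  have CF: "C * F \<in> carrier_mat p m" using C F by auto
  have "C * F * ?R' * (E * B) = C * F * (?R' * E) * B"
    unfolding assoc_mult_mat[OF CF R'(1) mult_carrier_mat[OF E B]]
      assoc_mult_mat[OF CF mult_carrier_mat[OF R'(1) E] B] assoc_mult_mat[OF R'(1) E B] ..
  also have "\<dots> = C * F * E * ?R * B"
    unfolding ER assoc_mult_mat[OF CF E R(1)] ..
  finally show ?thesis unfolding CFE .
qed

text \<open>
  Coordinates for the quotient of the space by the line through \<open>x\<close>: \<open>E\<close> is the quotient map,
  \<open>F\<close> a section of it, and \<open>F E\<close> differs from the identity by a matrix of rank one
  with range spanned by \<open>x\<close>.
\<close>

lemma project_along_vector:
  fixes x :: "complex vec"
  assumes x: "x \<in> carrier_vec n" "x \<noteq> 0\<^sub>v n"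
  obtains E F t where "E \<in> carrier_mat (n - 1) n" "F \<in> carrier_mat n (n - 1)"
    "t \<in> carrier_mat 1 n" "E *\<^sub>v x = 0\<^sub>v (n - 1)" "F * E = 1\<^sub>m n - mat n 1 (\<lambda>(i, _). x $ i) * t"
proof -
  obtain k where k: "k < n" "x $ k \<noteq> 0"
    using x by (metis carrier_vecD eq_vecI index_zero_vec(1,2))
  \<comment> \<open>With \<open>x\<close> nonzero at \<open>k\<close>, \<open>E\<close> clears coordinate \<open>k\<close> by a multiple of \<open>x\<close> and then drops it;
    \<open>ins\<close> enumerates the remaining coordinates.\<close>
  define ins where "ins i = (if i < k then i else Suc i)" for i
  define E where "E = mat (n - 1) n
    (\<lambda>(i, j). if j = ins i then 1 else if j = k then - x $ ins i / x $ k else 0)"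
  define F where "F = mat n (n - 1) (\<lambda>(i, j). if i = ins j then 1 else 0 :: complex)"
  define t where "t = mat 1 n (\<lambda>(_, j). if j = k then 1 / x $ k else 0)"
  have ins: "ins i < n" "ins i \<noteq> k" if "i < n - 1" for i
    using that by (auto simp: ins_def)
  have ins_inj: "ins i = ins j \<longleftrightarrow> i = j" for i j by (auto simp: ins_def)
  have ins_surj: "\<exists>i<n - 1. j = ins i" if "j < n" "j \<noteq> k" for j
    using that k by (intro exI[of _ "if j < k then j else j - 1"]) (auto simp: ins_def)
  show thesis
  proof (rule that[of E F t])
    show "E *\<^sub>v x = 0\<^sub>v (n - 1)"
    proof (rule eq_vecI)
      fix i assume "i < dim_vec (0\<^sub>v (n - 1) :: complex vec)"
      then have i: "i < n - 1" by simp
      have "(E *\<^sub>v x) $ i = (\<Sum>j<n. (if j = ins i then 1 else if j = k then - x $ ins i / x $ k else 0) * x $ j)"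
        using x(1) i by (simp add: E_def scalar_prod_def atLeast0LessThan)
      also have "\<dots> = (\<Sum>j<n. (if j = ins i then x $ ins i else 0) + (if j = k then - x $ ins i else 0))"
        using ins[OF i] k by (intro sum.cong) auto
      also have "\<dots> = 0" using ins[OF i] k by (simp add: sum.distrib)
      finally show "(E *\<^sub>v x) $ i = 0\<^sub>v (n - 1) $ i" using i by simp
    qed (simp add: E_def)
    show "F * E = 1\<^sub>m n - mat n 1 (\<lambda>(i, _). x $ i) * t"
    proof (rule eq_matI)
      fix i j assume "i < dim_row (1\<^sub>m n - mat n 1 (\<lambda>(i, _). x $ i) * t)"
        "j < dim_col (1\<^sub>m n - mat n 1 (\<lambda>(i, _). x $ i) * t)"
      then have ij: "i < n" "j < n" by (auto simp: t_def)
      have rhs: "(1\<^sub>m n - mat n 1 (\<lambda>(i, _). x $ i) * t) $$ (i, j) =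
          (if i = j then 1 else 0) - (if j = k then x $ i / x $ k else 0)"
        using ij by (simp add: t_def scalar_prod_def)
      have lhs: "(F * E) $$ (i, j) = (\<Sum>l<n - 1. (if i = ins l then 1 else 0) *
          (if j = ins l then 1 else if j = k then - x $ ins l / x $ k else 0))"
        using ij by (simp add: F_def E_def scalar_prod_def atLeast0LessThan)
      show "(F * E) $$ (i, j) = (1\<^sub>m n - mat n 1 (\<lambda>(i, _). x $ i) * t) $$ (i, j)"
      proof (cases "i = k")
        case True
        have "(F * E) $$ (i, j) = 0"
          unfolding lhs using ins True by (intro sum.neutral) auto
        then show ?thesis unfolding rhs using True k by auto
      next
        case False
        then obtain m where m: "m < n - 1" "i = ins m" using ins_surj ij by blast
        have "(F * E) $$ (i, j) = (\<Sum>l<n - 1. if l = m then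
          (if j = ins m then 1 else if j = k then - x $ ins m / x $ k else 0) else 0)"
          unfolding lhs using m(2) by (intro sum.cong) (auto simp: ins_inj)
        also have "\<dots> = (if j = i then 1 else if j = k then - x $ i / x $ k else 0)"
          using m by simp
        finally show ?thesis unfolding rhs using False by auto
      qed
    qed (auto simp: F_def E_def t_def)
  qed (auto simp: E_def F_def t_def)
qed

text \<open>
  An eigenvector of \<open>A\<close> in the kernel of \<open>C\<close> does not influence the output, so that dividing the
  state space by the line through it gives a realization of degree \<open>n - 1\<close>.
\<close>

lemma minimal_realization_no_unobservable_eigenvector:
  assumes G: "rational_mat_fun p G"
    and min: "minimal_realization p n G A B C D"
    and x: "eigenvector A x e"
  shows "C *\<^sub>v x \<noteq> 0\<^sub>v p"
proof
  assume Cx: "C *\<^sub>v x = 0\<^sub>v p"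
  have real: "realization p n G A B C D" using min by (simp add: minimal_realization_def)
  then have A: "A \<in> carrier_mat n n" and B: "B \<in> carrier_mat n p"
    and C: "C \<in> carrier_mat p n" and D: "D \<in> carrier_mat p p"
    and Geq: "\<And>z. \<not> eigenvalue A z \<Longrightarrow> G z = D + C * resolvent n A z * B"
    by (auto simp: realization_def)
  have xc: "x \<in> carrier_vec n" "x \<noteq> 0\<^sub>v n" and Ax: "A *\<^sub>v x = e \<cdot>\<^sub>v x"
    using x A by (auto simp: eigenvector_def)
  have n: "n > 0" using eigenvalue_imp_nonzero_dim[OF A] x by (auto simp: eigenvalue_def)
  obtain E F t where E: "E \<in> carrier_mat (n - 1) n" and F: "F \<in> carrier_mat n (n - 1)"
    and t: "t \<in> carrier_mat 1 n" and Ex: "E *\<^sub>v x = 0\<^sub>v (n - 1)"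
    and FE: "F * E = 1\<^sub>m n - mat n 1 (\<lambda>(i, _). x $ i) * t"
    using project_along_vector[OF xc] by blast
  define X where "X = mat n 1 (\<lambda>(i, _). x $ i)"
  have X: "X \<in> carrier_mat n 1" by (simp add: X_def)
  have MX: "M * X = 0\<^sub>m m 1" if M: "M \<in> carrier_mat m n" and "M *\<^sub>v x = 0\<^sub>v m" for M m
  proof (rule eq_matI)
    fix i j assume "i < dim_row (0\<^sub>m m 1 :: complex mat)" "j < dim_col (0\<^sub>m m 1 :: complex mat)"
    then have ij: "i < m" "j = 0" by auto
    have "(M * X) $$ (i, j) = (M *\<^sub>v x) $ i"
      using M X ij xc by (simp add: X_def scalar_prod_def)
    then show "(M * X) $$ (i, j) = 0\<^sub>m m 1 $$ (i, j)" using that ij by simp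
  qed (use M X in auto)
  \<comment> \<open>A matrix that kills \<open>x\<close> factors through the quotient by the line through \<open>x\<close>.\<close>
  have MFE: "M * F * E = M" if M: "M \<in> carrier_mat m n" and Mx: "M *\<^sub>v x = 0\<^sub>v m" for M m
  proof -
    have "M * F * E = M * (1\<^sub>m n - X * t)"
      using M F E by (simp add: assoc_mult_mat[of _ m n _ "n - 1" _ n] FE X_def)
    also have "\<dots> = M - M * X * t"
      using M X t by (simp add: mult_minus_distrib_mat[of _ m n _ n] assoc_mult_mat[of _ m n _ 1 _ n])
    also have "\<dots> = M" unfolding MX[OF M Mx] using M t by (intro eq_matI) auto
    finally show ?thesis .
  qed
  have EAx: "E * A *\<^sub>v x = 0\<^sub>v (n - 1)"
    unfolding assoc_mult_mat_vec[OF E A xc(1)] Ax mult_mat_vec[OF E xc(1)] Ex by (intro eq_vecI) auto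
  have EA: "E * A \<in> carrier_mat (n - 1) n" using E A by auto
  let ?A' = "E * A * F"
  have A': "?A' \<in> carrier_mat (n - 1) (n - 1)" using E A F by auto
  have "realization p (n - 1) G ?A' (E * B) (C * F) D"
  proof (rule realization_of_almost_everywhere[OF G A'])
    show "finite ({z. eigenvalue A z} \<union> {z. eigenvalue ?A' z})"
      using finite_eigenvalues[OF A] finite_eigenvalues[OF A'] by simp
    show "G z = D + C * F * resolvent (n - 1) ?A' z * (E * B)"
      if "z \<notin> {z. eigenvalue A z} \<union> {z. eigenvalue ?A' z}" for z
      using that Geq[of z]
        transfer_function_compression[OF A B C E F MFE[OF EA EAx] MFE[OF C Cx], of z]
      by simp
  qed (use E B C F D in auto)
  then have "n \<le> n - 1" using min unfolding minimal_realization_def by blast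
  then show False using n by simp
qed

lemma minimal_realization_observable:
  assumes G: "rational_mat_fun p G"
    and min: "minimal_realization p n G A B C D"
  shows "observable_pair n C A"
  unfolding observable_pair_def
proof (intro ballI impI, rule ccontr)
  fix x assume x: "x \<in> carrier_vec n" and nz: "x \<noteq> 0\<^sub>v n"
    and ker: "\<forall>k<n. (C * A ^\<^sub>m k) *\<^sub>v x = 0\<^sub>v (dim_row C)"
  have A: "A \<in> carrier_mat n n" and C: "C \<in> carrier_mat p n"
    using min by (auto simp: minimal_realization_def realization_def)
  obtain es where es: "length es = n" "\<forall>e\<in>set es. eigenvalue A e"
    "\<forall>x\<in>carrier_vec n. fold (\<lambda>e v. A *\<^sub>v v - e \<cdot>\<^sub>v v) es x = 0\<^sub>v n"
    using eigenvalues_annihilate[OF A] by blast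
  obtain y e where "eigenvector A y e" "C *\<^sub>v y = 0\<^sub>v p"
    using unobservable_vector_gives_eigenvector[OF A C x nz bspec[OF es(3) x]] es(1) ker C by auto
  then show False
    using minimal_realization_no_unobservable_eigenvector[OF G min] by blast
qed

section \<open>Stability and the Stein equation\<close>

text \<open>
  For an eigenvector \<open>x\<close> with eigenvalue \<open>e\<close>, the isometry condition reads
  \<open>(1 - |e|\<^sup>2) |x|\<^sup>2 = |C x|\<^sup>2\<close>, and observability makes the right-hand side positive.
\<close>

lemma output_normal_stable:
  fixes A C :: "complex mat"
  assumes A: "A \<in> carrier_mat n n" and C: "C \<in> carrier_mat p n"
    and iso: "mat_adjoint C * C + mat_adjoint A * A = 1\<^sub>m n"
    and obs: "\<And>x e. eigenvector A x e \<Longrightarrow> C *\<^sub>v x \<noteq> 0\<^sub>v p"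
  shows "stable_mat A"
  unfolding stable_mat_def
proof (intro allI impI)
  fix e assume "eigenvalue A e"
  then obtain x where ev: "eigenvector A x e" by (auto simp: eigenvalue_def)
  then have x: "x \<in> carrier_vec n" "x \<noteq> 0\<^sub>v n" and Ax: "A *\<^sub>v x = e \<cdot>\<^sub>v x"
    using A by (auto simp: eigenvector_def)
  have Cx: "C *\<^sub>v x \<in> carrier_vec p" and Axc: "A *\<^sub>v x \<in> carrier_vec n" using A C x by auto
  have "x = (mat_adjoint C * C + mat_adjoint A * A) *\<^sub>v x" using iso x by simp
  also have "\<dots> = mat_adjoint C *\<^sub>v (C *\<^sub>v x) + mat_adjoint A *\<^sub>v (A *\<^sub>v x)"
    using A C x assoc_mult_mat_vec[OF mat_adjoint_carrier[OF C] C x(1)]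
      assoc_mult_mat_vec[OF mat_adjoint_carrier[OF A] A x(1)]
      add_mult_distrib_mat_vec[OF mult_carrier_mat[OF mat_adjoint_carrier[OF C] C]
        mult_carrier_mat[OF mat_adjoint_carrier[OF A] A] x(1)]
    by simp
  finally have "x \<bullet>c x = (mat_adjoint C *\<^sub>v (C *\<^sub>v x) + mat_adjoint A *\<^sub>v (A *\<^sub>v x)) \<bullet>c x"
    by (rule arg_cong)
  also have "\<dots> = (mat_adjoint C *\<^sub>v (C *\<^sub>v x)) \<bullet>c x + (mat_adjoint A *\<^sub>v (A *\<^sub>v x)) \<bullet>c x"
    using mult_mat_vec_carrier[OF mat_adjoint_carrier[OF C] Cx]
      mult_mat_vec_carrier[OF mat_adjoint_carrier[OF A] Axc] x(1)
    by (intro add_scalar_prod_distrib[of _ n]) auto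
  also have "\<dots> = (C *\<^sub>v x) \<bullet>c (C *\<^sub>v x) + (A *\<^sub>v x) \<bullet>c (A *\<^sub>v x)"
    using mat_adjoint_cscalar_prod[OF C Cx x(1)] mat_adjoint_cscalar_prod[OF A Axc x(1)] by simp
  finally have split: "x \<bullet>c x = (C *\<^sub>v x) \<bullet>c (C *\<^sub>v x) + (A *\<^sub>v x) \<bullet>c (A *\<^sub>v x)" .
  have "Re ((A *\<^sub>v x) \<bullet>c (A *\<^sub>v x)) = (cmod e)\<^sup>2 * Re (x \<bullet>c x)"
    unfolding cscalar_prod_self[OF Axc] cscalar_prod_self[OF x(1)] Re_complex_of_real
    using x(1) by (simp add: Ax norm_mult power_mult_distrib sum_distrib_left)
  then have norms: "Re (x \<bullet>c x) = Re ((C *\<^sub>v x) \<bullet>c (C *\<^sub>v x)) + (cmod e)\<^sup>2 * Re (x \<bullet>c x)"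
    using arg_cong[OF split, of Re] by (simp only: plus_complex.sel)
  have "0 < Re ((C *\<^sub>v x) \<bullet>c (C *\<^sub>v x))"
    using cscalar_prod_self_pos[OF Cx] obs[OF ev] by simp
  then have "(cmod e)\<^sup>2 * Re (x \<bullet>c x) < 1 * Re (x \<bullet>c x)" using norms by simp
  then have "(cmod e)\<^sup>2 < 1"
    using cscalar_prod_self_pos[OF x] by (simp only: mult_less_cancel_right_pos)
  then show "cmod e < 1" by (simp add: power_less_one_iff abs_square_less_1)
qed

text \<open>
  The conjugate transpose of \<open>I - z A\<^sup>*\<close> is the matrix \<open>I - cnj z A\<close>, whose kernel vectors would be eigenvectors
  of \<open>A\<close> for an eigenvalue \<open>1 / cnj z\<close> outside the open disc.
\<close>

lemma stable_adjoint_pencil_inverse: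
  fixes A :: "complex mat"
  assumes A: "A \<in> carrier_mat n n" and st: "stable_mat A" and z: "cmod z \<le> 1"
  obtains L where "L \<in> carrier_mat n n"
    "(1\<^sub>m n - z \<cdot>\<^sub>m mat_adjoint A) * L = 1\<^sub>m n" "L * (1\<^sub>m n - z \<cdot>\<^sub>m mat_adjoint A) = 1\<^sub>m n"
proof -
  let ?M = "1\<^sub>m n - cnj z \<cdot>\<^sub>m A"
  have M: "?M \<in> carrier_mat n n" using A by auto
  have adj: "mat_adjoint ?M = 1\<^sub>m n - z \<cdot>\<^sub>m mat_adjoint A"
    using A by (intro eq_matI) auto
  have ker: "v = 0\<^sub>v n" if v: "v \<in> carrier_vec n" and 0: "?M *\<^sub>v v = 0\<^sub>v n" for v
  proof (rule ccontr)
    assume nz: "v \<noteq> 0\<^sub>v n"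
    have "?M *\<^sub>v v = v - cnj z \<cdot>\<^sub>v (A *\<^sub>v v)"
      using A v by (subst minus_mult_distrib_mat_vec[of _ n n]) auto
    then have eq: "v - cnj z \<cdot>\<^sub>v (A *\<^sub>v v) = 0\<^sub>v n" using 0 by simp
    have fix_v: "v $ i = cnj z * (A *\<^sub>v v) $ i" if "i < n" for i
      using arg_cong[OF eq, of "\<lambda>w :: complex vec. w $ i"] A v that by auto
    have z0: "z \<noteq> 0"
      using fix_v v nz by (metis carrier_vecD complex_cnj_zero eq_vecI index_zero_vec mult_zero_left)
    have "A *\<^sub>v v = (1 / cnj z) \<cdot>\<^sub>v v"
      using A v z0 fix_v by (intro eq_vecI) auto
    then have "eigenvalue A (1 / cnj z)"
      using A v nz by (auto simp: eigenvalue_def eigenvector_def)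
    then have "cmod (1 / cnj z) < 1" using st by (simp add: stable_mat_def)
    then show False using z z0 by (simp add: norm_divide)
  qed
  note K = mat_inverse_inverts[OF M ker]
  show thesis
  proof (rule that[of "mat_adjoint (the (mat_inverse ?M))"])
    show "(1\<^sub>m n - z \<cdot>\<^sub>m mat_adjoint A) * mat_adjoint (the (mat_inverse ?M)) = 1\<^sub>m n"
      using mat_adjoint_mult[OF K(1) M] K(3) by (simp add: adj mat_adjoint_one)
    show "mat_adjoint (the (mat_inverse ?M)) * (1\<^sub>m n - z \<cdot>\<^sub>m mat_adjoint A) = 1\<^sub>m n"
      using mat_adjoint_mult[OF M K(1)] K(2) by (simp add: adj mat_adjoint_one)
  qed (use K in auto)
qed

text \<open>
  From \<open>X = A\<^sup>* X A\<close> one gets \<open>(I - e A\<^sup>*) X v = A\<^sup>* X (A - e I) v\<close>. For an eigenvalue \<open>e\<close> the matrix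
  on the left is invertible by stability, so that \<open>X v = 0\<close> follows from \<open>X (A - e I) v = 0\<close>. As
  the product of all factors \<open>A - e I\<close> annihilates every vector, \<open>X\<close> annihilates every vector.
\<close>

lemma stable_stein_homogeneous:
  fixes A X :: "complex mat"
  assumes A: "A \<in> carrier_mat n n" and st: "stable_mat A"
    and X: "X \<in> carrier_mat n n" and eq: "X = mat_adjoint A * X * A"
  shows "X = 0\<^sub>m n n"
proof (rule mat_eq_zeroI[OF X])
  fix v :: "complex vec" assume v: "v \<in> carrier_vec n"
  obtain es where es: "length es = n" "\<forall>e\<in>set es. eigenvalue A e"
    "\<forall>x\<in>carrier_vec n. fold (\<lambda>e v. A *\<^sub>v v - e \<cdot>\<^sub>v v) es x = 0\<^sub>v n"
    using eigenvalues_annihilate[OF A] by blast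
  show "X *\<^sub>v v = 0\<^sub>v n" using bspec[OF es(3) v] v es(2)
  proof (induction es arbitrary: v)
    case Nil
    then show ?case using X by auto
  next
    case (Cons e es)
    let ?w = "A *\<^sub>v v - e \<cdot>\<^sub>v v"
    have w: "?w \<in> carrier_vec n" using A Cons.prems by auto
    have "X *\<^sub>v ?w = 0\<^sub>v n" using Cons.IH[OF _ w] Cons.prems by auto
    moreover have "X *\<^sub>v ?w = X *\<^sub>v (A *\<^sub>v v) - e \<cdot>\<^sub>v (X *\<^sub>v v)"
      using X A Cons.prems by (simp add: mult_minus_distrib_mat_vec[of _ n n] mult_mat_vec[of _ n n])
    ultimately have eq0: "X *\<^sub>v (A *\<^sub>v v) - e \<cdot>\<^sub>v (X *\<^sub>v v) = 0\<^sub>v n" by simp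
    have "(X *\<^sub>v (A *\<^sub>v v)) $ i = (e \<cdot>\<^sub>v (X *\<^sub>v v)) $ i" if "i < n" for i
      using arg_cong[OF eq0, of "\<lambda>w :: complex vec. w $ i"] A X that by auto
    then have XA: "X *\<^sub>v (A *\<^sub>v v) = e \<cdot>\<^sub>v (X *\<^sub>v v)"
      using A X by (intro eq_vecI) auto
    have u: "X *\<^sub>v v \<in> carrier_vec n" using X Cons.prems by auto
    have Ah: "mat_adjoint A \<in> carrier_mat n n" using A by auto
    have "X *\<^sub>v v = (mat_adjoint A * X * A) *\<^sub>v v" by (rule arg_cong[OF eq])
    also have "\<dots> = mat_adjoint A *\<^sub>v (X *\<^sub>v (A *\<^sub>v v))"
      unfolding assoc_mult_mat_vec[OF mult_carrier_mat[OF Ah X] A Cons.prems(2)]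
        assoc_mult_mat_vec[OF Ah X mult_mat_vec_carrier[OF A Cons.prems(2)]] ..
    also have "\<dots> = e \<cdot>\<^sub>v (mat_adjoint A *\<^sub>v (X *\<^sub>v v))"
      unfolding XA using Ah u by (rule mult_mat_vec)
    finally have fixed: "X *\<^sub>v v = e \<cdot>\<^sub>v (mat_adjoint A *\<^sub>v (X *\<^sub>v v))" .
    have "cmod e \<le> 1" using Cons.prems(3) st by (simp add: stable_mat_def order_less_imp_le)
    then obtain L where L: "L \<in> carrier_mat n n" "L * (1\<^sub>m n - e \<cdot>\<^sub>m mat_adjoint A) = 1\<^sub>m n"
      using stable_adjoint_pencil_inverse[OF A st] by metis
    have "(1\<^sub>m n - e \<cdot>\<^sub>m mat_adjoint A) *\<^sub>v (X *\<^sub>v v) = X *\<^sub>v v - e \<cdot>\<^sub>v (mat_adjoint A *\<^sub>v (X *\<^sub>v v))"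
      using Ah u by (subst minus_mult_distrib_mat_vec[of _ n n]) (auto simp: smult_mat_mult_vec[OF Ah u])
    also have "\<dots> = 0\<^sub>v n" unfolding fixed[symmetric] using u by simp
    finally have zero: "(1\<^sub>m n - e \<cdot>\<^sub>m mat_adjoint A) *\<^sub>v (X *\<^sub>v v) = 0\<^sub>v n" .
    have "X *\<^sub>v v = (L * (1\<^sub>m n - e \<cdot>\<^sub>m mat_adjoint A)) *\<^sub>v (X *\<^sub>v v)" using L u by simp
    also have "\<dots> = L *\<^sub>v ((1\<^sub>m n - e \<cdot>\<^sub>m mat_adjoint A) *\<^sub>v (X *\<^sub>v v))"
      using Ah u by (intro assoc_mult_mat_vec[OF L(1)] minus_carrier_mat) auto
    also have "\<dots> = 0\<^sub>v n" unfolding zero using L(1) by auto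
    finally show ?case .
  qed
qed

lemma stein_solution_unique:
  assumes W: "W \<in> carrier_mat n n" and st: "stable_mat W"
    and P: "stein_solution n U W V P" and Q: "stein_solution n U W V Q"
  shows "Q = P"
proof -
  have Pc: "P \<in> carrier_mat n n" and Qc: "Q \<in> carrier_mat n n"
    and eq: "P - mat_adjoint W * P * W = Q - mat_adjoint W * Q * W"
    using P Q by (auto simp: stein_solution_def)
  have "mat_adjoint W * (Q - P) * W = (mat_adjoint W * Q - mat_adjoint W * P) * W"
    using W Pc Qc by (subst mult_minus_distrib_mat[of _ n n _ n]) auto
  also have "\<dots> = mat_adjoint W * Q * W - mat_adjoint W * P * W"
    using W Pc Qc by (subst minus_mult_distrib_mat[of _ n n _ _ n])
      (auto intro!: mult_carrier_mat[of _ n n])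
  finally have e: "mat_adjoint W * (Q - P) * W = mat_adjoint W * Q * W - mat_adjoint W * P * W" .
  have "Q - P = mat_adjoint W * (Q - P) * W"
  proof -
    have "(Q - P) $$ (i, j) = (mat_adjoint W * Q * W - mat_adjoint W * P * W) $$ (i, j)"
      if "i < n" "j < n" for i j
      using arg_cong[OF eq, of "\<lambda>M. M $$ (i, j)"] that W Pc Qc
      by (simp del: index_mult_mat(1) add: algebra_simps)
    then show ?thesis unfolding e using W Pc Qc by (intro eq_matI) auto
  qed
  then have "Q - P = 0\<^sub>m n n"
    using stable_stein_homogeneous[OF W st minus_carrier_mat[OF Pc]] by blast
  then have "(Q - P) $$ (i, j) = 0" if "i < n" "j < n" for i j using that by simp
  then show ?thesis using Pc Qc by (intro eq_matI) auto
qed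

section \<open>Schur parameter of a balanced realization\<close>

text \<open>
  The last block column of the identity \<open>M\<^sup>* M = I\<close> for the realization matrix \<open>M\<close>.
\<close>

lemma unitary_block_columns:
  fixes A B C D :: "complex mat"
  assumes U: "unitary_mat (p + n) (four_block_mat D C B A)"
    and A: "A \<in> carrier_mat n n" and B: "B \<in> carrier_mat n p"
    and C: "C \<in> carrier_mat p n" and D: "D \<in> carrier_mat p p"
  shows "mat_adjoint D * C + mat_adjoint B * A = 0\<^sub>m p n"
    and "mat_adjoint C * C + mat_adjoint A * A = 1\<^sub>m n"
proof -
  note ad = mat_adjoint_carrier[OF A] mat_adjoint_carrier[OF B]
    mat_adjoint_carrier[OF C] mat_adjoint_carrier[OF D]
  let ?P = "mat_adjoint D * D + mat_adjoint B * B" and ?Q = "mat_adjoint D * C + mat_adjoint B * A"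
  let ?R = "mat_adjoint C * D + mat_adjoint A * B" and ?S = "mat_adjoint C * C + mat_adjoint A * A"
  have eq: "four_block_mat ?P ?Q ?R ?S = 1\<^sub>m (p + n)"
    using U mult_four_block_mat[OF ad(4) ad(2) ad(3) ad(1) D C B A]
    unfolding unitary_mat_def mat_adjoint_four_block[OF D C B A] by simp
  show "?Q = 0\<^sub>m p n"
  proof (rule eq_matI)
    fix i j assume "i < dim_row (0\<^sub>m p n :: complex mat)" "j < dim_col (0\<^sub>m p n :: complex mat)"
    then have ij: "i < p" "j < n" by auto
    have "?Q $$ (i, j) = four_block_mat ?P ?Q ?R ?S $$ (i, p + j)"
      using ij A B C D by (subst index_mat_four_block) auto
    then show "?Q $$ (i, j) = 0\<^sub>m p n $$ (i, j)" unfolding eq using ij by simp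
  qed (use A B C D in auto)
  show "?S = 1\<^sub>m n"
  proof (rule eq_matI)
    fix i j assume "i < dim_row (1\<^sub>m n :: complex mat)" "j < dim_col (1\<^sub>m n :: complex mat)"
    then have ij: "i < n" "j < n" by auto
    have "?S $$ (i, j) = four_block_mat ?P ?Q ?R ?S $$ (p + i, p + j)"
      using ij A B C D by (subst index_mat_four_block) auto
    then show "?S $$ (i, j) = 1\<^sub>m n $$ (i, j)" unfolding eq using ij by simp
  qed (use A B C D in auto)
qed

text \<open>
  On the unit circle \<open>G\<^sup>\<sharp>(z) = G(z)\<^sup>* = D\<^sup>* + T C\<^sup>*\<close> with \<open>T = B\<^sup>* ((z I - A)\<^sup>-\<^sup>1)\<^sup>*\<close>. The relations
  between the blocks turn \<open>(D\<^sup>* + T C\<^sup>*) C\<close> into \<open>cnj z T (z I - A)\<close>, so that the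
  resolvent, with all its poles in the disc, cancels.
\<close>

lemma balanced_integrand_on_circle:
  assumes A: "A \<in> carrier_mat n n" and B: "B \<in> carrier_mat n p"
    and C: "C \<in> carrier_mat p n" and D: "D \<in> carrier_mat p p"
    and orth: "mat_adjoint D * C + mat_adjoint B * A = 0\<^sub>m p n"
    and iso: "mat_adjoint C * C + mat_adjoint A * A = 1\<^sub>m n"
    and G: "G z = D + C * resolvent n A z * B"
    and z: "cmod z = 1" and ev: "\<not> eigenvalue A z"
  shows "sharp G z * C * resolvent n A z = cnj z \<cdot>\<^sub>m (mat_adjoint B * mat_adjoint (resolvent n A z))"
proof -
  let ?R = "resolvent n A z"
  note R = resolvent_inverts[OF A ev]
  define Ah Bh Ch Dh S where defs: "Ah = mat_adjoint A" "Bh = mat_adjoint B" "Ch = mat_adjoint C"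
    "Dh = mat_adjoint D" "S = mat_adjoint ?R"
  have ad: "Ah \<in> carrier_mat n n" "Bh \<in> carrier_mat p n" "Ch \<in> carrier_mat n p" "Dh \<in> carrier_mat p p"
    "S \<in> carrier_mat n n"
    unfolding defs using A B C D R(1) by auto
  define T where "T = Bh * S"
  have T: "T \<in> carrier_mat p n" unfolding T_def using ad by auto
  have zz: "cnj z * z = 1"
    using z complex_norm_square[of z] by (simp add: mult.commute)
  have sharp: "sharp G z = Dh + T * Ch"
  proof -
    have "cnj z \<noteq> 0" using z by auto
    then have "1 / cnj z = z" using zz by (simp add: divide_eq_eq mult.commute)
    then have "sharp G z = mat_adjoint (D + C * ?R * B)" by (simp add: sharp_def G)
    also have "\<dots> = Dh + Bh * (S * Ch)"
      unfolding defs mat_adjoint_add[OF D mult_carrier_mat[OF mult_carrier_mat[OF C R(1)] B]]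
        mat_adjoint_mult[OF mult_carrier_mat[OF C R(1)] B] mat_adjoint_mult[OF C R(1)] ..
    also have "Bh * (S * Ch) = T * Ch"
      unfolding T_def assoc_mult_mat[OF ad(2) ad(5) ad(3)] ..
    finally show ?thesis .
  qed
  have ZA: "z \<cdot>\<^sub>m 1\<^sub>m n - A \<in> carrier_mat n n" by (rule minus_carrier_mat[OF A])
  have S: "S * (cnj z \<cdot>\<^sub>m 1\<^sub>m n - Ah) = 1\<^sub>m n"
    using mat_adjoint_mult[OF ZA R(1)] R(2) unfolding defs mat_adjoint_shift[OF A]
    by (simp add: mat_adjoint_one)
  have shift: "T * (c \<cdot>\<^sub>m 1\<^sub>m n - M) = c \<cdot>\<^sub>m T - T * M" if M: "M \<in> carrier_mat n n" for c M
    using T M mult_smult_distrib[OF T one_carrier_mat, of c]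
    by (subst mult_minus_distrib_mat[OF T _ M]) auto
  have TAh: "cnj z \<cdot>\<^sub>m T - T * Ah = Bh"
  proof -
    have "cnj z \<cdot>\<^sub>m T - T * Ah = T * (cnj z \<cdot>\<^sub>m 1\<^sub>m n - Ah)" using shift[OF ad(1)] by simp
    also have "\<dots> = Bh * (S * (cnj z \<cdot>\<^sub>m 1\<^sub>m n - Ah))"
      unfolding T_def by (rule assoc_mult_mat[OF ad(2) ad(5) minus_carrier_mat[OF ad(1)]])
    finally show ?thesis unfolding S using ad(2) by simp
  qed
  have e1: "Dh * C + Bh * A = 0\<^sub>m p n" using orth by (simp add: defs)
  have e2: "T * Ch * C + T * Ah * A = T"
  proof -
    have "T * Ch * C + T * Ah * A = T * (Ch * C + Ah * A)"
      unfolding assoc_mult_mat[OF T ad(3) C] assoc_mult_mat[OF T ad(1) A]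
      by (rule mult_add_distrib_mat[OF T mult_carrier_mat[OF ad(3) C] mult_carrier_mat[OF ad(1) A], symmetric])
    then show ?thesis using iso T by (simp add: defs)
  qed
  have e3: "cnj z \<cdot>\<^sub>m (T * A) - T * Ah * A = Bh * A"
    using minus_mult_distrib_mat[OF smult_carrier_mat[OF T, of "cnj z"] mult_carrier_mat[OF T ad(1)] A]
      mult_smult_assoc_mat[OF T A] TAh by simp
  have dims: "Dh * C \<in> carrier_mat p n" "Bh * A \<in> carrier_mat p n" "T * Ch * C \<in> carrier_mat p n"
    "T * Ah * A \<in> carrier_mat p n" "T * A \<in> carrier_mat p n"
    by (rule mult_carrier_mat[OF ad(4) C] mult_carrier_mat[OF ad(2) A]
        mult_carrier_mat[OF mult_carrier_mat[OF T ad(3)] C]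
        mult_carrier_mat[OF mult_carrier_mat[OF T ad(1)] A] mult_carrier_mat[OF T A])+
  have sum: "Dh * C + T * Ch * C = cnj z \<cdot>\<^sub>m (z \<cdot>\<^sub>m T - T * A)"
  proof -
    \<comment> \<open>The products stay opaque, so that only their linear relations are used entrywise.\<close>
    have lin: "a + c = cnj z \<cdot>\<^sub>m (z \<cdot>\<^sub>m T - f)"
      if car: "a \<in> carrier_mat p n" "b \<in> carrier_mat p n" "c \<in> carrier_mat p n"
        "d \<in> carrier_mat p n" "f \<in> carrier_mat p n"
        and rel: "a + b = 0\<^sub>m p n" "c + d = T" "cnj z \<cdot>\<^sub>m f - d = b" for a b c d f
    proof (rule eq_matI)
      fix i j assume "i < dim_row (cnj z \<cdot>\<^sub>m (z \<cdot>\<^sub>m T - f))" "j < dim_col (cnj z \<cdot>\<^sub>m (z \<cdot>\<^sub>m T - f))"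
      then have ij: "i < p" "j < n" using car by auto
      have "a $$ (i, j) + b $$ (i, j) = 0" "c $$ (i, j) + d $$ (i, j) = T $$ (i, j)"
        "cnj z * f $$ (i, j) - d $$ (i, j) = b $$ (i, j)"
        using arg_cong[OF rel(1), of "\<lambda>M. M $$ (i, j)"] arg_cong[OF rel(2), of "\<lambda>M. M $$ (i, j)"]
          arg_cong[OF rel(3), of "\<lambda>M. M $$ (i, j)"] ij car by auto
      then have "a $$ (i, j) + c $$ (i, j) = T $$ (i, j) - cnj z * f $$ (i, j)"
        by (simp add: algebra_simps)
      also have "\<dots> = cnj z * (z * T $$ (i, j) - f $$ (i, j))"
        by (simp add: right_diff_distrib mult.assoc[symmetric] zz)
      finally show "(a + c) $$ (i, j) = (cnj z \<cdot>\<^sub>m (z \<cdot>\<^sub>m T - f)) $$ (i, j)"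
        using ij car T by simp
    qed (use car T in auto)
    show ?thesis by (rule lin[OF dims e1 e2 e3])
  qed
  have "sharp G z * C = Dh * C + T * Ch * C"
    unfolding sharp by (rule add_mult_distrib_mat[OF ad(4) mult_carrier_mat[OF T ad(3)] C])
  also have "\<dots> = cnj z \<cdot>\<^sub>m (T * (z \<cdot>\<^sub>m 1\<^sub>m n - A))"
    unfolding sum shift[OF A] ..
  finally have "sharp G z * C * ?R = cnj z \<cdot>\<^sub>m (T * (z \<cdot>\<^sub>m 1\<^sub>m n - A) * ?R)"
    using mult_smult_assoc_mat[OF mult_carrier_mat[OF T ZA] R(1)] by simp
  also have "T * (z \<cdot>\<^sub>m 1\<^sub>m n - A) * ?R = T"
    unfolding assoc_mult_mat[OF T ZA R(1)] R(2) using T by simp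
  finally show ?thesis unfolding T_def defs .
qed

text \<open>
  The matrix \<open>cnj z ((z I - A)\<^sup>-\<^sup>1)\<^sup>*\<close> coincides on the unit circle with
  \<open>L z = (I - z A\<^sup>*)\<^sup>-\<^sup>1\<close>, which is holomorphic on the closed disc because \<open>A\<close> is stable. The
  integrand of the Schur parameter is therefore the boundary value of the holomorphic function
  \<open>B\<^sup>* L z\<close>, and Cauchy's theorem applies.
\<close>

lemma balanced_schur_parameter_zero:
  assumes A: "A \<in> carrier_mat n n" and B: "B \<in> carrier_mat n p"
    and C: "C \<in> carrier_mat p n" and D: "D \<in> carrier_mat p p"
    and orth: "mat_adjoint D * C + mat_adjoint B * A = 0\<^sub>m p n"
    and iso: "mat_adjoint C * C + mat_adjoint A * A = 1\<^sub>m n"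
    and G: "\<And>z. \<not> eigenvalue A z \<Longrightarrow> G z = D + C * resolvent n A z * B"
    and st: "stable_mat A"
  shows "schur_parameter p n C A G = 0\<^sub>m p n"
proof -
  have "\<forall>z\<in>cball 0 1. \<exists>L. L \<in> carrier_mat n n \<and> (1\<^sub>m n - z \<cdot>\<^sub>m mat_adjoint A) * L = 1\<^sub>m n \<and>
    L * (1\<^sub>m n - z \<cdot>\<^sub>m mat_adjoint A) = 1\<^sub>m n"
    using stable_adjoint_pencil_inverse[OF A st] by (metis mem_cball_0)
  then obtain L where L: "\<And>z. z \<in> cball 0 1 \<Longrightarrow> L z \<in> carrier_mat n n"
    "\<And>z. z \<in> cball 0 1 \<Longrightarrow> (1\<^sub>m n - z \<cdot>\<^sub>m mat_adjoint A) * L z = 1\<^sub>m n"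
    "\<And>z. z \<in> cball 0 1 \<Longrightarrow> L z * (1\<^sub>m n - z \<cdot>\<^sub>m mat_adjoint A) = 1\<^sub>m n"
    by metis
  have Lhol: "(\<lambda>z. L z $$ (k, j)) holomorphic_on cball 0 1" if "k < n" "j < n" for k j
  proof (rule inverse_entry_holomorphic_on[where M = "\<lambda>z. 1\<^sub>m n - z \<cdot>\<^sub>m mat_adjoint A"])
    show "1\<^sub>m n - z \<cdot>\<^sub>m mat_adjoint A \<in> carrier_mat n n" for z
      using A by (intro minus_carrier_mat) auto
    show "(\<lambda>z. (1\<^sub>m n - z \<cdot>\<^sub>m mat_adjoint A) $$ (i, l)) holomorphic_on cball 0 1"
      if "i < n" "l < n" for i l
      using A that by (auto intro!: holomorphic_intros)
  qed (use L that in auto)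
  have circle: "sharp G z * C * resolvent n A z = mat_adjoint B * L z" if z: "cmod z = 1" for z
  proof -
    have ev: "\<not> eigenvalue A z" using st z by (auto simp: stable_mat_def)
    note R = resolvent_inverts[OF A ev]
    define S where "S = mat_adjoint (resolvent n A z)"
    define Ah where "Ah = mat_adjoint A"
    have S: "S \<in> carrier_mat n n" and Ah: "Ah \<in> carrier_mat n n"
      unfolding S_def Ah_def using R(1) A by auto
    have zz: "cnj z * z = 1"
      using z complex_norm_square[of z] by (simp add: mult.commute)
    have Lz: "L z \<in> carrier_mat n n" "L z * (1\<^sub>m n - z \<cdot>\<^sub>m Ah) = 1\<^sub>m n"
      unfolding Ah_def using L(1,3) z by auto
    have M: "1\<^sub>m n - z \<cdot>\<^sub>m Ah \<in> carrier_mat n n"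
      using Ah by (intro minus_carrier_mat) auto
    have "(cnj z \<cdot>\<^sub>m 1\<^sub>m n - Ah) * S = 1\<^sub>m n"
      using mat_adjoint_mult[OF R(1) minus_carrier_mat[OF A, of "z \<cdot>\<^sub>m 1\<^sub>m n"]] R(3)
      unfolding S_def Ah_def mat_adjoint_shift[OF A] by (simp add: mat_adjoint_one)
    moreover have "cnj z \<cdot>\<^sub>m 1\<^sub>m n - Ah = cnj z \<cdot>\<^sub>m (1\<^sub>m n - z \<cdot>\<^sub>m Ah)"
      using Ah zz by (intro eq_matI) (auto simp: right_diff_distrib mult.assoc[symmetric])
    ultimately have inv: "(1\<^sub>m n - z \<cdot>\<^sub>m Ah) * (cnj z \<cdot>\<^sub>m S) = 1\<^sub>m n"
      using mult_smult_assoc_mat[OF M S] mult_smult_distrib[OF M S] by simp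
    have "L z = L z * ((1\<^sub>m n - z \<cdot>\<^sub>m Ah) * (cnj z \<cdot>\<^sub>m S))" using Lz inv by simp
    also have "\<dots> = L z * (1\<^sub>m n - z \<cdot>\<^sub>m Ah) * (cnj z \<cdot>\<^sub>m S)"
      by (rule assoc_mult_mat[OF Lz(1) M smult_carrier_mat[OF S], symmetric])
    also have "\<dots> = cnj z \<cdot>\<^sub>m S" using Lz S by simp
    finally have "mat_adjoint B * L z = cnj z \<cdot>\<^sub>m (mat_adjoint B * S)"
      using mult_smult_distrib[OF mat_adjoint_carrier[OF B] S] by simp
    then show ?thesis
      using balanced_integrand_on_circle[where G = G and z = z, OF A B C D orth iso G[OF ev] z ev] by (simp add: S_def)
  qed
  have int: "contour_integral (circlepath 0 1) (\<lambda>z. (sharp G z * C * resolvent n A z) $$ (i, j)) = 0"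
    if ij: "i < p" "j < n" for i j
  proof -
    have "((\<lambda>z. \<Sum>k<n. mat_adjoint B $$ (i, k) * L z $$ (k, j)) has_contour_integral 0) (circlepath 0 1)"
    proof (rule Cauchy_theorem_convex_simple)
      show "(\<lambda>z. \<Sum>k<n. mat_adjoint B $$ (i, k) * L z $$ (k, j)) holomorphic_on cball 0 1"
        using Lhol ij by (intro holomorphic_intros) auto
    qed auto
    then have "((\<lambda>z. (sharp G z * C * resolvent n A z) $$ (i, j)) has_contour_integral 0) (circlepath 0 1)"
    proof (rule has_contour_integral_eq)
      fix z assume "z \<in> path_image (circlepath (0 :: complex) 1)"
      then have z: "cmod z = 1" by simp
      then show "(\<Sum>k<n. mat_adjoint B $$ (i, k) * L z $$ (k, j)) = (sharp G z * C * resolvent n A z) $$ (i, j)"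
        unfolding circle[OF z] using L(1)[of z] B ij
        by (simp add: scalar_prod_def atLeast0LessThan)
    qed
    then show ?thesis by (rule contour_integral_unique)
  qed
  show ?thesis
    unfolding schur_parameter_def using int by (intro eq_matI) auto
qed

theorem proposition6:
  fixes G :: "complex \<Rightarrow> complex mat" and p n :: nat and A B C D :: "complex mat"
  assumes "G \<in> lossless_functions p n"
    and "balanced_realization p n G A B C D"
  shows "output_normal_pair p n C A \<and> adapted_chart p n C A G"
proof -
  have rat: "rational_mat_fun p G"
    using assms(1) by (simp add: lossless_functions_def lossless_def)
  have min: "minimal_realization p n G A B C D"
    and U: "unitary_mat (p + n) (four_block_mat D C B A)"
    using assms(2) by (auto simp: balanced_realization_def)
  then have A: "A \<in> carrier_mat n n" and B: "B \<in> carrier_mat n p"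
    and C: "C \<in> carrier_mat p n" and D: "D \<in> carrier_mat p p"
    and G: "\<And>z. \<not> eigenvalue A z \<Longrightarrow> G z = D + C * resolvent n A z * B"
    by (auto simp: minimal_realization_def realization_def)
  note cols = unitary_block_columns[OF U A B C D]
  have st: "stable_mat A"
    by (rule output_normal_stable[OF A C cols(2)])
      (rule minimal_realization_no_unobservable_eigenvector[OF rat min])
  have pair: "output_normal_pair p n C A"
    unfolding output_normal_pair_def
    using A C cols(2) st minimal_realization_observable[OF rat min] by simp
  have V: "schur_parameter p n C A G = 0\<^sub>m p n"
    by (rule balanced_schur_parameter_zero[OF A B C D cols G st])
  have stein: "stein_solution n C A (0\<^sub>m p n) (1\<^sub>m n)"
  proof -
    have "mat_adjoint A * 1\<^sub>m n * A = mat_adjoint A * A" using A by simp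
    moreover have "mat_adjoint (0\<^sub>m p n) * 0\<^sub>m p n = (0\<^sub>m n n :: complex mat)"
      by (rule right_mult_zero_mat[OF mat_adjoint_carrier]) simp
    moreover have "1\<^sub>m n - mat_adjoint A * A = mat_adjoint C * C - 0\<^sub>m n n"
      unfolding cols(2)[symmetric] using A C by (intro eq_matI) auto
    ultimately show ?thesis by (simp add: stein_solution_def)
  qed
  have "pos_def_mat n (1\<^sub>m n)"
    by (auto simp: pos_def_mat_def hermitian_mat_def mat_adjoint_one cscalar_prod_self_pos)
  then have "in_chart_domain p n C A G"
    unfolding in_chart_domain_def V
    using assms(1) stein stein_solution_unique[OF A st stein] by blast
  then show ?thesis using pair V by (simp add: adapted_chart_def)
qed

end
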